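(* Let $G$ be a subgroup of the homeomorphism group of a Hausdorff topological space $X$. If the $G$-action on $X$ is micro-supported and has a compressible open set, then the intersection $M$ of all non-trivial normal subgroups of $G$ is non-trivial. If in addition the $M$-action on $X$ admits a compressible open set, then $M$ is simple.
   Context: An action of a group $G$ by homeomorphisms on a topological space $X$ is micro-supported if for every non-empty open subset $Y$ of $X$, the pointwise stabiliser in $G$ of the complement $X \setminus Y$ acts non-trivially on $Y$. A subset $V$ of $X$ is compressible (for the $G$-action) if it is non-empty and for every non-empty open subset $Y$ of $X$ there exists $g \in G$ such that $gV \subseteq Y$; for the $M$-action, $g$ is required to lie in $M$. No topology on $G$ is involved; normal subgroups are not required to be closed. *)

theory Defs
  imports "HOL-Analysis.Analysis" "HOL-Algebra.Bij" "HOL-Algebra.Coset"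
begin

definition homeo_set :: "'a topology \<Rightarrow> ('a \<Rightarrow> 'a) set"
  where "homeo_set X = {f \<in> Bij (topspace X). homeomorphic_map X X f}"

text \<open>As in \<^const>\<open>BijGroup\<close>, the elements are extensional functions, so that distinct
  elements differ at a point of the space, and the product is composition.\<close>

definition HomeoGroup :: "'a topology \<Rightarrow> ('a \<Rightarrow> 'a) monoid"
  where "HomeoGroup X = (BijGroup (topspace X))\<lparr>carrier := homeo_set X\<rparr>"

lemma subgroup_homeo_set: "subgroup (homeo_set X) (BijGroup (topspace X))"
proof (rule subgroup.intro)
  show "homeo_set X \<subseteq> carrier (BijGroup (topspace X))"
    by (auto simp: homeo_set_def BijGroup_def)
next
  fix f g assume fg: "f \<in> homeo_set X" "g \<in> homeo_set X"
  then have "homeomorphic_map X X (f \<circ> g)"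
    unfolding homeo_set_def using homeomorphic_map_compose by blast
  then have "homeomorphic_map X X (compose (topspace X) f g)"
    by (rule homeomorphic_map_eq) (simp add: compose_def)
  with fg show "f \<otimes>\<^bsub>BijGroup (topspace X)\<^esub> g \<in> homeo_set X"
    by (simp add: homeo_set_def BijGroup_def compose_Bij)
next
  have "homeomorphic_map X X (\<lambda>x\<in>topspace X. x)"
    by (rule homeomorphic_map_eq [where f = id]) auto
  then show "\<one>\<^bsub>BijGroup (topspace X)\<^esub> \<in> homeo_set X"
    by (simp add: homeo_set_def BijGroup_def id_Bij)
next
  fix f assume f: "f \<in> homeo_set X"
  then obtain g where g: "homeomorphic_maps X X f g"
    unfolding homeo_set_def homeomorphic_map_maps by blast
  then have "homeomorphic_map X X g"
    using homeomorphic_map_maps homeomorphic_maps_sym by blast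
  moreover have "g x = (\<lambda>x\<in>topspace X. inv_into (topspace X) f x) x"
    if "x \<in> topspace X" for x
  proof -
    have "inj_on f (topspace X)"
      using f by (simp add: homeo_set_def homeomorphic_map_def)
    moreover have "g x \<in> topspace X" "f (g x) = x"
      using g that by (auto simp: homeomorphic_maps_def continuous_map_def)
    ultimately show ?thesis
      using that by (metis inv_into_f_f restrict_apply')
  qed
  ultimately have "homeomorphic_map X X (\<lambda>x\<in>topspace X. inv_into (topspace X) f x)"
    by (rule homeomorphic_map_eq)
  with f show "inv\<^bsub>BijGroup (topspace X)\<^esub> f \<in> homeo_set X"
    by (simp add: homeo_set_def inv_BijGroup restrict_inv_into_Bij)
qed

lemma group_HomeoGroup: "group (HomeoGroup X)"
  unfolding HomeoGroup_def
  by (rule subgroup.subgroup_is_group [OF subgroup_homeo_set group_BijGroup])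

text \<open>In the next three definitions \<open>G\<close> is a set of self-maps of the space, acting by
  evaluation.\<close>

definition pointwise_stabiliser :: "('a \<Rightarrow> 'a) set \<Rightarrow> 'a set \<Rightarrow> ('a \<Rightarrow> 'a) set"
  where "pointwise_stabiliser G A = {g \<in> G. \<forall>x\<in>A. g x = x}"

definition micro_supported :: "'a topology \<Rightarrow> ('a \<Rightarrow> 'a) set \<Rightarrow> bool"
  where "micro_supported X G \<longleftrightarrow>
    (\<forall>Y. openin X Y \<and> Y \<noteq> {} \<longrightarrow>
      (\<exists>g \<in> pointwise_stabiliser G (topspace X - Y). \<exists>y\<in>Y. g y \<noteq> y))"

definition compressible :: "'a topology \<Rightarrow> ('a \<Rightarrow> 'a) set \<Rightarrow> 'a set \<Rightarrow> bool"
  where "compressible X G V \<longleftrightarrow>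
    V \<subseteq> topspace X \<and> V \<noteq> {} \<and>
    (\<forall>Y. openin X Y \<and> Y \<noteq> {} \<longrightarrow> (\<exists>g\<in>G. g ` V \<subseteq> Y))"

text \<open>The intersection is taken inside the group: for a trivial group, which has no
  non-trivial normal subgroup, it is the whole group.\<close>

definition monolith :: "('a, 'b) monoid_scheme \<Rightarrow> 'a set"
  where "monolith G = carrier G \<inter> \<Inter>{N. N \<lhd> G \<and> N \<noteq> {\<one>\<^bsub>G\<^esub>}}"

text \<open>The locale \<open>simple_group\<close> of HOL-Algebra requires \<^term>\<open>order G > 1\<close>, which excludes all
  infinite groups because \<^const>\<open>order\<close> is a cardinality that is 0 for infinite carriers.\<close>

definition is_simple :: "('a, 'b) monoid_scheme \<Rightarrow> bool"
  where "is_simple G \<longleftrightarrow>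
    group G \<and> carrier G \<noteq> {\<one>\<^bsub>G\<^esub>} \<and>
    (\<forall>N. N \<lhd> G \<longrightarrow> N = {\<one>\<^bsub>G\<^esub>} \<or> N = carrier G)"

end

theory Submission
  imports Defs
begin

text \<open>Let \<open>V\<close> be an open compressible set and \<open>N\<close> a non-trivial normal subgroup. Some element of
  \<open>N\<close> moves a small open set off itself, and conjugating it by an element that compresses \<open>V\<close> into
  that set gives \<open>n \<in> N\<close> with \<open>n V \<inter> V = {}\<close>. If \<open>a, b \<in> G\<close> are supported in \<open>V\<close>, then \<open>a\<close> commutes
  with \<open>n b\<^sup>-\<^sup>1 n\<^sup>-\<^sup>1\<close>, so \<open>[a, b] = [a, [b, n]] \<in> N\<close>. Hence the monolith \<open>M\<close> contains all these
  commutators; as this holds for every translate of \<open>V\<close>, the action of \<open>M\<close> is again micro-supported.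
  If \<open>M\<close> also has a compressible open set, then the monolith of \<open>M\<close> is non-trivial; it is
  characteristic in \<open>M\<close>, hence normal in \<open>G\<close>, hence all of \<open>M\<close>.\<close>

section \<open>The monolith of a group\<close>

lemma (in group) commutator_eq_one_iff:
  assumes "a \<in> carrier G" "b \<in> carrier G"
  shows "a \<otimes> b \<otimes> inv a \<otimes> inv b = \<one> \<longleftrightarrow> a \<otimes> b = b \<otimes> a"
proof -
  have "a \<otimes> b \<otimes> inv a \<otimes> inv b = (a \<otimes> b) \<otimes> inv (b \<otimes> a)"
    using assms by (simp add: inv_mult_group m_assoc)
  then show ?thesis
    using assms by (metis inv_equality inv_inv inv_closed m_closed r_inv)
qed

text \<open>With \<open>c = n b^-1 n^-1\<close>, the product \<open>b c = (b n b^-1) n^-1\<close>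
  lies in \<open>N\<close>, hence so does \<open>[a, b c] = (a (b c) a^-1) (b c)^-1\<close>. As
  \<open>a\<close> commutes with \<open>c\<close>, the factor \<open>c\<close> cancels and
  \<open>[a, b c] = [a, b]\<close>.\<close>

lemma (in group) commutator_mem_normal:
  assumes N: "N \<lhd> G" and n: "n \<in> N" and a: "a \<in> carrier G" and b: "b \<in> carrier G"
    and comm: "a \<otimes> (n \<otimes> inv b \<otimes> inv n) = (n \<otimes> inv b \<otimes> inv n) \<otimes> a"
  shows "a \<otimes> b \<otimes> inv a \<otimes> inv b \<in> N"
proof -
  interpret N: normal N G by (rule N)
  have nG: "n \<in> carrier G" using n by (rule N.mem_carrier)
  define c where "c = n \<otimes> inv b \<otimes> inv n"
  have c: "c \<in> carrier G" using nG b by (simp add: c_def)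
  have "b \<otimes> c = (b \<otimes> n \<otimes> inv b) \<otimes> inv n"
    using nG b by (simp add: c_def m_assoc)
  then have bc: "b \<otimes> c \<in> N"
    using N.inv_op_closed2 [OF b n] n by simp
  have "a \<otimes> (b \<otimes> c) \<otimes> inv a \<otimes> inv (b \<otimes> c) = a \<otimes> b \<otimes> (c \<otimes> inv a \<otimes> inv c) \<otimes> inv b"
    using a b c by (simp add: inv_mult_group m_assoc)
  also have "c \<otimes> inv a \<otimes> inv c = inv a"
  proof -
    have "c = a \<otimes> c \<otimes> inv a"
      using comm a c by (simp add: c_def [symmetric] inv_solve_right)
    then have "inv a \<otimes> c = c \<otimes> inv a"
      using a c by (metis inv_closed inv_solve_left m_assoc m_closed)
    then show ?thesis using a c by (metis inv_closed inv_solve_right m_closed)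
  qed
  finally show ?thesis
    using N.inv_op_closed2 [OF a bc] bc by (metis N.m_closed N.m_inv_closed)
qed

section \<open>Normality of the monolith and simplicity\<close>

lemma (in group) monolith_normal: "monolith G \<lhd> G"
proof -
  \<comment> \<open>Inserting the carrier makes the family non-empty even for a trivial group, as an
    intersection of subgroups requires.\<close>
  have "monolith G = \<Inter>(insert (carrier G) {N. N \<lhd> G \<and> N \<noteq> {\<one>}})"
    by (auto simp: monolith_def)
  moreover have "subgroup (\<Inter>(insert (carrier G) {N. N \<lhd> G \<and> N \<noteq> {\<one>}})) G"
    by (rule subgroups_Inter) (auto simp: subgroup_self normal_imp_subgroup)
  ultimately have "subgroup (monolith G) G" by simp
  then show ?thesis
    unfolding normal_inv_iff by (auto simp: monolith_def normal.inv_op_closed2)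
qed

text \<open>This set is \<open>g^-1 N g\<close>, written as the preimage of \<open>N\<close> under
  the automorphism of \<open>M\<close> given by conjugation by \<open>g\<close>. Each closure
  property then follows from the same property of \<open>N\<close>, because conjugation respects
  products and inverses.\<close>

lemma (in group) conjugate_normal:
  assumes M: "M \<lhd> G" and N: "N \<lhd> G\<lparr>carrier := M\<rparr>" and g: "g \<in> carrier G"
  shows "{x \<in> M. g \<otimes> x \<otimes> inv g \<in> N} \<lhd> G\<lparr>carrier := M\<rparr>" (is "?N' \<lhd> ?M")
proof -
  interpret M: normal M G by (rule M)
  interpret MG: group ?M by (rule subgroup_imp_group [OF M.subgroup_axioms])
  interpret N: normal N ?M by (rule N)
  have MG: "x \<in> carrier G" if "x \<in> M" for x using that by (rule M.mem_carrier)
  \<comment> \<open>Product and unit survive the record update, but an inverse is chosen inside the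
    carrier, so the two inverses have to be identified.\<close>
  have inv_eq: "inv\<^bsub>?M\<^esub> x = inv x" if "x \<in> M" for x
    using that m_inv_consistent [OF M.subgroup_axioms] by simp
  have conj_mult: "g \<otimes> (x \<otimes> y) \<otimes> inv g = (g \<otimes> x \<otimes> inv g) \<otimes> (g \<otimes> y \<otimes> inv g)"
    if "x \<in> carrier G" "y \<in> carrier G" for x y
  proof -
    have "(g \<otimes> x \<otimes> inv g) \<otimes> (g \<otimes> y \<otimes> inv g) = g \<otimes> x \<otimes> (inv g \<otimes> g) \<otimes> y \<otimes> inv g"
      using that g by (simp only: m_assoc m_closed inv_closed)
    then show ?thesis using that g by (simp add: m_assoc)
  qed
  have conj_inv: "g \<otimes> inv x \<otimes> inv g = inv (g \<otimes> x \<otimes> inv g)" if "x \<in> carrier G" for x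
    using that g by (simp only: inv_mult_group m_assoc m_closed inv_closed inv_inv)
  have conj_M: "g \<otimes> x \<otimes> inv g \<in> M" if "x \<in> M" for x
    using g that by (rule M.inv_op_closed2)
  have N_mult: "x \<otimes> y \<in> N" if "x \<in> N" "y \<in> N" for x y
    using N.m_closed [OF that] by simp
  have N_M: "x \<in> M" if "x \<in> N" for x
    using N.subset that by auto
  have N_inv: "inv x \<in> N" if "x \<in> N" for x
    using N.m_inv_closed [OF that] inv_eq [OF N_M [OF that]] by simp
  have N_conj: "x \<otimes> y \<otimes> inv x \<in> N" if "x \<in> M" "y \<in> N" for x y
    using N.inv_op_closed2 [of x y] that by (simp add: inv_eq)
  show ?thesis
    unfolding MG.normal_inv_iff
  proof (intro conjI ballI)
    show "subgroup ?N' ?M"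
    proof (rule MG.subgroupI)
      show "?N' \<noteq> {}"
        using N.one_closed g by (auto intro!: exI [of _ \<one>])
    next
      fix x assume "x \<in> ?N'"
      then show "inv\<^bsub>?M\<^esub> x \<in> ?N'"
        by (simp add: inv_eq MG conj_inv N_inv)
    next
      fix x y assume "x \<in> ?N'" "y \<in> ?N'"
      then show "x \<otimes>\<^bsub>?M\<^esub> y \<in> ?N'"
        by (simp add: MG conj_mult N_mult)
    qed auto
  next
    fix x h assume "x \<in> carrier ?M" "h \<in> ?N'"
    then show "x \<otimes>\<^bsub>?M\<^esub> h \<otimes>\<^bsub>?M\<^esub> inv\<^bsub>?M\<^esub> x \<in> ?N'"
      by (simp add: inv_eq MG conj_mult conj_inv conj_M N_conj)
  qed
qed

text \<open>Conjugation by an element of \<open>G\<close> permutes the non-trivial normal subgroups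
  of \<open>M\<close>, so it preserves their intersection.\<close>

lemma (in group) monolith_monolith_normal:
  assumes M: "M \<lhd> G"
  shows "monolith (G\<lparr>carrier := M\<rparr>) \<lhd> G" (is "monolith ?M \<lhd> G")
proof -
  interpret M: normal M G by (rule M)
  interpret MG: group ?M by (rule subgroup_imp_group [OF M.subgroup_axioms])
  have sub: "subgroup (monolith ?M) G"
    by (rule incl_subgroup [OF M.subgroup_axioms normal_imp_subgroup [OF MG.monolith_normal]])
  show ?thesis
    unfolding normal_inv_iff
  proof (intro conjI ballI sub)
    fix g m assume g: "g \<in> carrier G" and m: "m \<in> monolith ?M"
    then have "m \<in> M" by (simp add: monolith_def)
    \<comment> \<open>Equivalently, \<open>m\<close> lies in \<open>g^-1 N g\<close>. That is a
      normal subgroup of \<open>M\<close>, so it contains \<open>m\<close> once it is known to be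
      non-trivial; the conjugate \<open>l\<close> of \<open>k\<close> witnesses this.\<close>
    moreover have "g \<otimes> m \<otimes> inv g \<in> N" if N: "N \<lhd> ?M" "N \<noteq> {\<one>}" for N
    proof -
      have subN: "subgroup N ?M" using N(1) by (rule normal_imp_subgroup)
      then obtain k where k: "k \<in> N" "k \<noteq> \<one>"
        using N(2) subgroup.one_closed [OF subN] by auto
      have kM: "k \<in> M" using subgroup.subset [OF subN] k(1) by auto
      define l where "l = inv g \<otimes> k \<otimes> g"
      have lM: "l \<in> M" unfolding l_def using kM g by (rule M.inv_op_closed1 [rotated])
      have "g \<otimes> l \<otimes> inv g = k"
      proof -
        have "g \<otimes> l \<otimes> inv g = (g \<otimes> inv g) \<otimes> k \<otimes> (g \<otimes> inv g)"
          using g M.mem_carrier [OF kM] unfolding l_def by (simp only: m_assoc m_closed inv_closed)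
        then show ?thesis using g M.mem_carrier [OF kM] by simp
      qed
      moreover from this have "l \<noteq> \<one>" using k(2) g by auto
      ultimately have "{x \<in> M. g \<otimes> x \<otimes> inv g \<in> N} \<noteq> {\<one>}"
        using lM k(1) by blast
      then have "m \<in> {x \<in> M. g \<otimes> x \<otimes> inv g \<in> N}"
        using m conjugate_normal [OF M N(1) g] unfolding monolith_def by auto
      then show ?thesis by simp
    qed
    ultimately show "g \<otimes> m \<otimes> inv g \<in> monolith ?M"
      using g by (simp add: monolith_def M.inv_op_closed2)
  qed
qed

text \<open>The monolith of \<open>monolith G\<close> is normal in \<open>G\<close>; being
  non-trivial, it contains \<open>monolith G\<close>. So every non-trivial normal subgroup of
  \<open>monolith G\<close> is everything.\<close>

lemma (in group) is_simple_monolith: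
  assumes "monolith (G\<lparr>carrier := monolith G\<rparr>) \<noteq> {\<one>}"
  shows "is_simple (G\<lparr>carrier := monolith G\<rparr>)"
proof -
  let ?M = "G\<lparr>carrier := monolith G\<rparr>"
  interpret M: normal "monolith G" G by (rule monolith_normal)
  interpret MG: group ?M by (rule subgroup_imp_group [OF M.subgroup_axioms])
  have MM: "monolith G \<subseteq> monolith ?M"
    using monolith_monolith_normal [OF monolith_normal] assms by (auto simp: monolith_def [of G])
  have "N = monolith G" if "N \<lhd> ?M" "N \<noteq> {\<one>}" for N
    using that MM subgroup.subset [OF normal_imp_subgroup [OF that(1)]]
    by (auto simp: monolith_def [of ?M])
  moreover have "monolith G \<noteq> {\<one>}"
    using assms MM subgroup.one_closed [OF normal_imp_subgroup [OF MG.monolith_normal]]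
    by (auto simp: monolith_def [of ?M])
  ultimately show ?thesis
    by (auto simp: is_simple_def MG.group_axioms)
qed

section \<open>Groups of homeomorphisms\<close>

lemma carrier_HomeoGroup: "carrier (HomeoGroup X) = homeo_set X"
  by (simp add: HomeoGroup_def)

lemma one_HomeoGroup: "x \<in> topspace X \<Longrightarrow> \<one>\<^bsub>HomeoGroup X\<^esub> x = x"
  by (simp add: HomeoGroup_def BijGroup_def)

lemma mult_HomeoGroup:
  assumes "f \<in> homeo_set X" "g \<in> homeo_set X" "x \<in> topspace X"
  shows "(f \<otimes>\<^bsub>HomeoGroup X\<^esub> g) x = f (g x)"
  using assms by (simp add: HomeoGroup_def BijGroup_def homeo_set_def compose_def)

lemma homeo_set_closed: "f \<in> homeo_set X \<Longrightarrow> x \<in> topspace X \<Longrightarrow> f x \<in> topspace X"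
  by (auto simp: homeo_set_def Bij_def bij_betw_def)

lemma homeo_set_eq_iff:
  assumes "f \<in> homeo_set X" "g \<in> homeo_set X" "x \<in> topspace X" "y \<in> topspace X"
  shows "f x = f y \<longleftrightarrow> x = y"
  using assms by (auto simp: homeo_set_def Bij_def bij_betw_def inj_on_def)

lemma homeo_set_ext:
  assumes "f \<in> homeo_set X" "g \<in> homeo_set X" "\<And>x. x \<in> topspace X \<Longrightarrow> f x = g x"
  shows "f = g"
  using assms by (intro extensionalityI [of f "topspace X"]) (auto simp: homeo_set_def Bij_def)

lemma inv_HomeoGroup_closed: "f \<in> homeo_set X \<Longrightarrow> inv\<^bsub>HomeoGroup X\<^esub> f \<in> homeo_set X"
  using group.inv_closed [OF group_HomeoGroup, of f X] by (simp add: carrier_HomeoGroup)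

lemma mult_HomeoGroup_closed:
  "f \<in> homeo_set X \<Longrightarrow> g \<in> homeo_set X \<Longrightarrow> f \<otimes>\<^bsub>HomeoGroup X\<^esub> g \<in> homeo_set X"
  using monoid.m_closed [OF group.is_monoid [OF group_HomeoGroup], of f X g]
  by (simp add: carrier_HomeoGroup)

lemma inv_HomeoGroup_left:
  assumes "f \<in> homeo_set X" "x \<in> topspace X"
  shows "(inv\<^bsub>HomeoGroup X\<^esub> f) (f x) = x"
proof -
  let ?H = "HomeoGroup X"
  have "(inv\<^bsub>?H\<^esub> f \<otimes>\<^bsub>?H\<^esub> f) x = x"
    using assms group.l_inv [OF group_HomeoGroup, of f X]
    by (simp add: carrier_HomeoGroup one_HomeoGroup)
  then show ?thesis using assms by (simp add: mult_HomeoGroup inv_HomeoGroup_closed)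
qed

lemma inv_HomeoGroup_right:
  assumes "f \<in> homeo_set X" "x \<in> topspace X"
  shows "f ((inv\<^bsub>HomeoGroup X\<^esub> f) x) = x"
proof -
  let ?H = "HomeoGroup X"
  have "(f \<otimes>\<^bsub>?H\<^esub> inv\<^bsub>?H\<^esub> f) x = x"
    using assms group.r_inv [OF group_HomeoGroup, of f X]
    by (simp add: carrier_HomeoGroup one_HomeoGroup)
  then show ?thesis using assms by (simp add: mult_HomeoGroup inv_HomeoGroup_closed)
qed

lemma homeo_set_moves_point:
  assumes "f \<in> homeo_set X" "f \<noteq> \<one>\<^bsub>HomeoGroup X\<^esub>"
  obtains x where "x \<in> topspace X" "f x \<noteq> x"
proof -
  have "\<one>\<^bsub>HomeoGroup X\<^esub> \<in> homeo_set X"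
    using monoid.one_closed [OF group.is_monoid [OF group_HomeoGroup, of X]]
    by (simp add: carrier_HomeoGroup)
  with assms homeo_set_ext one_HomeoGroup that show ?thesis by metis
qed

lemma openin_homeo_image: "f \<in> homeo_set X \<Longrightarrow> openin X V \<Longrightarrow> openin X (f ` V)"
  using homeomorphic_imp_open_map [of X X f] by (simp add: homeo_set_def open_map_def)

section \<open>Displacement and disjoint supports\<close>

text \<open>Separate \<open>y\<close> and \<open>f y\<close> by disjoint open sets \<open>A\<close>
  and \<open>B\<close>, and take the points of \<open>Y \<inter> A\<close> that \<open>f\<close>
  sends into \<open>B\<close>.\<close>

lemma displaced_open_neighbourhood:
  assumes X: "Hausdorff_space X" and f: "f \<in> homeo_set X"
    and Y: "openin X Y" "y \<in> Y" and fy: "f y \<noteq> y"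
  obtains U where "openin X U" "y \<in> U" "U \<subseteq> Y" "f ` U \<inter> U = {}"
proof -
  have y: "y \<in> topspace X" using Y openin_subset by blast
  obtain A B where AB: "openin X A" "openin X B" "y \<in> A" "f y \<in> B" "disjnt A B"
    using X y homeo_set_closed [OF f y] fy unfolding Hausdorff_space_def by metis
  have "continuous_map X X f"
    using f homeomorphic_imp_continuous_map by (auto simp: homeo_set_def)
  then have "openin X {x \<in> topspace X. f x \<in> B}"
    using AB(2) openin_continuous_map_preimage by blast
  then have "openin X (Y \<inter> A \<inter> {x \<in> topspace X. f x \<in> B})"
    using Y(1) AB(1) by blast
  then show ?thesis
    by (rule that) (use AB Y y in \<open>auto simp: disjnt_def\<close>)
qed

lemma disjoint_supports_commute:
  assumes a: "a \<in> homeo_set X" "\<And>x. x \<in> topspace X - V \<Longrightarrow> a x = x"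
    and c: "c \<in> homeo_set X" "\<And>x. x \<in> topspace X - W \<Longrightarrow> c x = x"
    and VW: "V \<inter> W = {}"
  shows "a \<otimes>\<^bsub>HomeoGroup X\<^esub> c = c \<otimes>\<^bsub>HomeoGroup X\<^esub> a"
proof (rule homeo_set_ext)
  fix x assume x: "x \<in> topspace X"
  \<comment> \<open>If \<open>f x\<close> were outside \<open>A\<close>, then
    \<open>f (f x) = f x\<close>, and injectivity would give \<open>f x = x\<close>. So neither map
    carries a point it moves out of its own support.\<close>
  have pres: "f x = x \<or> f x \<in> A"
    if "f \<in> homeo_set X" "\<And>x. x \<in> topspace X - A \<Longrightarrow> f x = x" for f A
    using that x homeo_set_eq_iff homeo_set_closed by (metis DiffI)
  have "a (c x) = c (a x)"
    using pres [OF a] pres [OF c] a c VW x homeo_set_closed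
    by (metis DiffI disjoint_iff)
  then show "(a \<otimes>\<^bsub>HomeoGroup X\<^esub> c) x = (c \<otimes>\<^bsub>HomeoGroup X\<^esub> a) x"
    using a c x by (simp add: mult_HomeoGroup)
qed (use a c in \<open>simp_all add: mult_HomeoGroup_closed\<close>)

section \<open>Micro-supported actions with a compressible open set\<close>

lemma subgroup_HomeoGroup_subset:
  "subgroup G (HomeoGroup X) \<Longrightarrow> g \<in> G \<Longrightarrow> g \<in> homeo_set X"
  using subgroup.mem_carrier [of G "HomeoGroup X" g] by (simp add: carrier_HomeoGroup)

text \<open>If \<open>h\<close> compresses \<open>V\<close> into \<open>Y\<close>, then
  \<open>h g^-1\<close> compresses \<open>g V\<close> into \<open>Y\<close>. This makes it possible
  to work with a translate of \<open>V\<close> inside a prescribed open set.\<close>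

lemma compressible_image:
  assumes G: "subgroup G (HomeoGroup X)" and V: "compressible X G V" and g: "g \<in> G"
  shows "compressible X G (g ` V)"
  unfolding compressible_def
proof (intro conjI allI impI)
  have gX: "g \<in> homeo_set X" using G g by (rule subgroup_HomeoGroup_subset)
  have VX: "V \<subseteq> topspace X" using V by (simp add: compressible_def)
  show "g ` V \<subseteq> topspace X" using VX homeo_set_closed [OF gX] by blast
  show "g ` V \<noteq> {}" using V by (simp add: compressible_def)
  fix Y assume "openin X Y \<and> Y \<noteq> {}"
  then obtain h where h: "h \<in> G" "h ` V \<subseteq> Y"
    using V unfolding compressible_def by blast
  have hX: "h \<in> homeo_set X" using G h(1) by (rule subgroup_HomeoGroup_subset)
  have "(h \<otimes>\<^bsub>HomeoGroup X\<^esub> inv\<^bsub>HomeoGroup X\<^esub> g) (g x) = h x" if "x \<in> V" for x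
    using that VX hX gX
    by (simp add: subset_iff mult_HomeoGroup inv_HomeoGroup_closed homeo_set_closed
        inv_HomeoGroup_left)
  then have "(h \<otimes>\<^bsub>HomeoGroup X\<^esub> inv\<^bsub>HomeoGroup X\<^esub> g) ` (g ` V) \<subseteq> Y"
    using h(2) by auto
  moreover have "h \<otimes>\<^bsub>HomeoGroup X\<^esub> inv\<^bsub>HomeoGroup X\<^esub> g \<in> G"
    using G g h(1) by (simp add: subgroup.m_closed subgroup.m_inv_closed)
  ultimately show "\<exists>g'\<in>G. g' ` (g ` V) \<subseteq> Y" by blast
qed

text \<open>A non-trivial \<open>k \<in> N\<close> displaces some open \<open>U\<close>; if
  \<open>g\<close> compresses \<open>V\<close> into \<open>U\<close>, the conjugate
  \<open>g^-1 k g\<close> displaces \<open>V\<close>.\<close>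

lemma normal_displaces_compressible:
  assumes X: "Hausdorff_space X" and G: "subgroup G (HomeoGroup X)"
    and V: "compressible X G V"
    and N: "N \<lhd> (HomeoGroup X)\<lparr>carrier := G\<rparr>" "N \<noteq> {\<one>\<^bsub>HomeoGroup X\<^esub>}"
  obtains n where "n \<in> N" "n ` V \<inter> V = {}"
proof -
  let ?H = "HomeoGroup X"
  interpret N: normal N "?H\<lparr>carrier := G\<rparr>" by (rule N(1))
  obtain k where k: "k \<in> N" "k \<noteq> \<one>\<^bsub>?H\<^esub>"
    using N(2) subgroup.one_closed [OF N.subgroup_axioms] by auto
  have kX: "k \<in> homeo_set X"
    using N.subset k(1) subgroup_HomeoGroup_subset [OF G] by auto
  obtain x where x: "x \<in> topspace X" "k x \<noteq> x"
    using kX k(2) by (rule homeo_set_moves_point)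
  obtain U where U: "openin X U" "x \<in> U" "U \<subseteq> topspace X" "k ` U \<inter> U = {}"
    using displaced_open_neighbourhood [OF X kX openin_topspace x] .
  then obtain g where g: "g \<in> G" "g ` V \<subseteq> U"
    using V unfolding compressible_def by blast
  have gX: "g \<in> homeo_set X" using G g(1) by (rule subgroup_HomeoGroup_subset)
  define n where "n = inv\<^bsub>?H\<^esub> g \<otimes>\<^bsub>?H\<^esub> k \<otimes>\<^bsub>?H\<^esub> g"
  have "n \<in> N"
    using N.inv_op_closed1 [of g k] g(1) k(1)
    by (simp add: n_def group.m_inv_consistent [OF group_HomeoGroup G])
  moreover have "n ` V \<inter> V = {}"
  proof -
    have "n v \<notin> V" if v: "v \<in> V" for v
    proof
      assume nv: "n v \<in> V"
      have vX: "v \<in> topspace X" using V v by (auto simp: compressible_def)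
      \<comment> \<open>Here \<open>g v\<close> lies in \<open>U\<close>, so \<open>k (g v)\<close>
        does not; but \<open>n v \<in> V\<close> would put \<open>g (n v)\<close> in
        \<open>U\<close>.\<close>
      have "g (n v) = k (g v)"
        using vX gX kX
        by (simp add: n_def mult_HomeoGroup mult_HomeoGroup_closed inv_HomeoGroup_closed
            homeo_set_closed inv_HomeoGroup_right)
      then show False
        using U(4) g(2) v nv by (metis disjoint_iff image_subset_iff image_eqI)
    qed
    then show ?thesis by blast
  qed
  ultimately show ?thesis by (rule that)
qed

text \<open>For each non-trivial normal \<open>N\<close>, choose \<open>n \<in> N\<close> displacing
  \<open>V\<close>. The conjugate \<open>n b^-1 n^-1\<close> is supported in \<open>n V\<close>,
  away from the support of \<open>a\<close>, so the two commute and
  \<open>commutator_mem_normal\<close> applies.\<close>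

lemma commutator_mem_monolith:
  assumes X: "Hausdorff_space X" and G: "subgroup G (HomeoGroup X)"
    and V: "compressible X G V"
    and a: "a \<in> pointwise_stabiliser G (topspace X - V)"
    and b: "b \<in> pointwise_stabiliser G (topspace X - V)"
  shows "a \<otimes>\<^bsub>HomeoGroup X\<^esub> b \<otimes>\<^bsub>HomeoGroup X\<^esub> inv\<^bsub>HomeoGroup X\<^esub> a \<otimes>\<^bsub>HomeoGroup X\<^esub> inv\<^bsub>HomeoGroup X\<^esub> b
    \<in> monolith ((HomeoGroup X)\<lparr>carrier := G\<rparr>)" (is "?c \<in> monolith ?G")
proof -
  let ?H = "HomeoGroup X"
  interpret G: group ?G
    by (rule group.subgroup_imp_group [OF group_HomeoGroup G])
  have inv_eq: "inv\<^bsub>?G\<^esub> x = inv\<^bsub>?H\<^esub> x" if "x \<in> G" for x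
    using that by (simp add: group.m_inv_consistent [OF group_HomeoGroup G])
  have aG: "a \<in> G" and bG: "b \<in> G"
    and a_fix: "\<And>x. x \<in> topspace X - V \<Longrightarrow> a x = x"
    and b_fix: "\<And>x. x \<in> topspace X - V \<Longrightarrow> b x = x"
    using a b by (auto simp: pointwise_stabiliser_def)
  have aX: "a \<in> homeo_set X" and bX: "b \<in> homeo_set X"
    using aG bG subgroup_HomeoGroup_subset [OF G] by auto
  have "?c \<in> N" if N: "N \<lhd> ?G" "N \<noteq> {\<one>\<^bsub>?H\<^esub>}" for N
  proof -
    obtain n where n: "n \<in> N" "n ` V \<inter> V = {}"
      using normal_displaces_compressible [OF X G V N] .
    have nG: "n \<in> G"
      using subgroup.subset [OF normal_imp_subgroup [OF N(1)]] n(1) by auto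
    have nX: "n \<in> homeo_set X" using G nG by (rule subgroup_HomeoGroup_subset)
    define c where "c = n \<otimes>\<^bsub>?H\<^esub> inv\<^bsub>?H\<^esub> b \<otimes>\<^bsub>?H\<^esub> inv\<^bsub>?H\<^esub> n"
    have cX: "c \<in> homeo_set X"
      using nX bX by (simp add: c_def mult_HomeoGroup_closed inv_HomeoGroup_closed)
    have c_fix: "c x = x" if x: "x \<in> topspace X - n ` V" for x
    proof -
      define y where "y = (inv\<^bsub>?H\<^esub> n) x"
      have y: "y \<in> topspace X" "n y = x"
        using x nX by (auto simp: y_def homeo_set_closed inv_HomeoGroup_closed inv_HomeoGroup_right)
      then have "b y = y" using x b_fix by blast
      then have "(inv\<^bsub>?H\<^esub> b) y = y" using inv_HomeoGroup_left [OF bX y(1)] by simp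
      then show ?thesis
        using x y nX bX
        by (simp add: c_def y_def mult_HomeoGroup mult_HomeoGroup_closed inv_HomeoGroup_closed)
    qed
    have "a \<otimes>\<^bsub>?H\<^esub> c = c \<otimes>\<^bsub>?H\<^esub> a"
      using aX a_fix cX c_fix n(2)
      by (intro disjoint_supports_commute [where V = V and W = "n ` V"]) auto
    then show ?thesis
      using G.commutator_mem_normal [OF N(1) n(1), of a b] aG bG nG
      by (simp add: c_def inv_eq)
  qed
  \<comment> \<open>\<open>monolith\<close> intersects with the carrier, so membership in
    \<open>G\<close> is a separate obligation.\<close>
  moreover have "?c \<in> G"
    using aG bG G by (simp add: subgroup.m_closed subgroup.m_inv_closed)
  ultimately show ?thesis by (simp add: monolith_def)
qed

section \<open>Micro-support of the monolith\<close>

text \<open>Take \<open>a\<close> moving a point of \<open>V\<close>, then \<open>b\<close>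
  non-trivial with support in a small open \<open>W \<subseteq> V\<close> displaced by
  \<open>a\<close>. At a point \<open>z \<in> W\<close> moved by \<open>b\<close>, the two products
  differ: \<open>b (a z) = a z\<close>, since \<open>a z\<close> is outside \<open>W\<close>, while
  \<open>a (b z) \<noteq> a z\<close>.\<close>

lemma stabiliser_commutator_nontrivial:
  assumes X: "Hausdorff_space X" and G: "subgroup G (HomeoGroup X)"
    and ms: "micro_supported X G" and V: "openin X V" "V \<noteq> {}"
  obtains a b where "a \<in> pointwise_stabiliser G (topspace X - V)"
    "b \<in> pointwise_stabiliser G (topspace X - V)"
    "a \<otimes>\<^bsub>HomeoGroup X\<^esub> b \<noteq> b \<otimes>\<^bsub>HomeoGroup X\<^esub> a"
proof -
  let ?H = "HomeoGroup X"
  obtain a y where a: "a \<in> pointwise_stabiliser G (topspace X - V)" and y: "y \<in> V" "a y \<noteq> y"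
    using ms V unfolding micro_supported_def by blast
  have aX: "a \<in> homeo_set X"
    using a subgroup_HomeoGroup_subset [OF G] by (auto simp: pointwise_stabiliser_def)
  obtain W where W: "openin X W" "y \<in> W" "W \<subseteq> V" "a ` W \<inter> W = {}"
    using displaced_open_neighbourhood [OF X aX V(1) y] .
  then obtain b z where b: "b \<in> pointwise_stabiliser G (topspace X - W)" and z: "z \<in> W" "b z \<noteq> z"
    using ms unfolding micro_supported_def by blast
  have bX: "b \<in> homeo_set X"
    using b subgroup_HomeoGroup_subset [OF G] by (auto simp: pointwise_stabiliser_def)
  have zX: "z \<in> topspace X" using z(1) W(1) openin_subset by blast
  have "a z \<in> topspace X - W"
    using z(1) W(4) homeo_set_closed [OF aX zX] by blast
  then have "b (a z) = a z" using b by (simp add: pointwise_stabiliser_def)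
  moreover have "a (b z) \<noteq> a z"
    using z(2) aX bX zX by (simp add: homeo_set_eq_iff homeo_set_closed)
  ultimately have "a \<otimes>\<^bsub>?H\<^esub> b \<noteq> b \<otimes>\<^bsub>?H\<^esub> a"
    using mult_HomeoGroup [OF aX bX zX] mult_HomeoGroup [OF bX aX zX] by metis
  moreover have "b \<in> pointwise_stabiliser G (topspace X - V)"
    using b W(3) by (auto simp: pointwise_stabiliser_def)
  ultimately show ?thesis using a that by blast
qed

text \<open>A translate \<open>g V\<close> inside \<open>Y\<close> is again open and compressible.
  Two non-commuting elements supported in it have a non-trivial commutator, which lies in the
  monolith and fixes every point outside \<open>Y\<close>.\<close>

lemma micro_supported_monolith:
  assumes X: "Hausdorff_space X" and G: "subgroup G (HomeoGroup X)"
    and ms: "micro_supported X G" and V: "openin X V" "compressible X G V"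
  shows "micro_supported X (monolith ((HomeoGroup X)\<lparr>carrier := G\<rparr>))" (is "micro_supported X ?M")
  unfolding micro_supported_def
proof (intro allI impI)
  let ?H = "HomeoGroup X"
  fix Y assume "openin X Y \<and> Y \<noteq> {}"
  then obtain g where g: "g \<in> G" "g ` V \<subseteq> Y"
    using V(2) unfolding compressible_def by blast
  have W: "openin X (g ` V)" "compressible X G (g ` V)" "g ` V \<noteq> {}"
    using openin_homeo_image [OF subgroup_HomeoGroup_subset [OF G g(1)] V(1)]
      compressible_image [OF G V(2) g(1)] V(2) by (auto simp: compressible_def)
  obtain a b where a: "a \<in> pointwise_stabiliser G (topspace X - g ` V)"
    and b: "b \<in> pointwise_stabiliser G (topspace X - g ` V)"
    and ab: "a \<otimes>\<^bsub>?H\<^esub> b \<noteq> b \<otimes>\<^bsub>?H\<^esub> a"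
    using stabiliser_commutator_nontrivial [OF X G ms W(1,3)] .
  define c where "c = a \<otimes>\<^bsub>?H\<^esub> b \<otimes>\<^bsub>?H\<^esub> inv\<^bsub>?H\<^esub> a \<otimes>\<^bsub>?H\<^esub> inv\<^bsub>?H\<^esub> b"
  have aX: "a \<in> homeo_set X" and bX: "b \<in> homeo_set X"
    using a b subgroup_HomeoGroup_subset [OF G] by (auto simp: pointwise_stabiliser_def)
  have cM: "c \<in> ?M"
    unfolding c_def using X G W(2) a b by (rule commutator_mem_monolith)
  have c_fix: "c x = x" if x: "x \<in> topspace X - Y" for x
  proof -
    have "x \<in> topspace X - g ` V" and xX: "x \<in> topspace X"
      using x g(2) by blast+
    then have "a x = x" "b x = x"
      using a b by (simp_all add: pointwise_stabiliser_def)
    moreover from this have "(inv\<^bsub>?H\<^esub> a) x = x" "(inv\<^bsub>?H\<^esub> b) x = x"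
      using inv_HomeoGroup_left [OF aX xX] inv_HomeoGroup_left [OF bX xX] by auto
    ultimately show ?thesis
      using aX bX xX
      by (simp add: c_def mult_HomeoGroup mult_HomeoGroup_closed inv_HomeoGroup_closed)
  qed
  have "c \<noteq> \<one>\<^bsub>?H\<^esub>"
    using ab aX bX group.commutator_eq_one_iff [OF group_HomeoGroup, of a X b]
    by (simp add: c_def carrier_HomeoGroup)
  moreover have "c \<in> homeo_set X"
    using aX bX by (simp add: c_def mult_HomeoGroup_closed inv_HomeoGroup_closed)
  ultimately obtain y where "y \<in> topspace X" "c y \<noteq> y"
    by (metis homeo_set_moves_point)
  then have "y \<in> Y" "c y \<noteq> y" using c_fix by auto
  moreover have "c \<in> pointwise_stabiliser ?M (topspace X - Y)"
    using cM c_fix by (simp add: pointwise_stabiliser_def)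
  ultimately show "\<exists>g\<in>pointwise_stabiliser ?M (topspace X - Y). \<exists>y\<in>Y. g y \<noteq> y"
    by blast
qed

lemma micro_supported_nontrivial:
  assumes "micro_supported X M" "topspace X \<noteq> {}"
  shows "M \<noteq> {\<one>\<^bsub>HomeoGroup X\<^esub>}"
proof -
  obtain g y where "g \<in> M" "y \<in> topspace X" "g y \<noteq> y"
    using assms openin_topspace unfolding micro_supported_def pointwise_stabiliser_def by blast
  then show ?thesis using one_HomeoGroup by fastforce
qed

theorem proposition8:
  fixes X :: "'a topology" and G :: "('a \<Rightarrow> 'a) set"
  assumes "Hausdorff_space X"
    and "subgroup G (HomeoGroup X)"
    and "micro_supported X G"
    and "\<exists>V. openin X V \<and> compressible X G V"
  shows "let M = monolith ((HomeoGroup X)\<lparr>carrier := G\<rparr>) in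
    M \<noteq> {\<one>\<^bsub>HomeoGroup X\<^esub>} \<and>
    ((\<exists>V. openin X V \<and> compressible X M V) \<longrightarrow> is_simple ((HomeoGroup X)\<lparr>carrier := M\<rparr>))"
proof -
  let ?H = "HomeoGroup X"
  let ?G = "?H\<lparr>carrier := G\<rparr>"
  define M where "M = monolith ?G"
  interpret G: group ?G
    by (rule group.subgroup_imp_group [OF group_HomeoGroup assms(2)])
  have M: "subgroup M ?H"
    using group.incl_subgroup [OF group_HomeoGroup assms(2)]
      normal_imp_subgroup [OF G.monolith_normal] by (simp add: M_def)
  obtain V where V: "openin X V" "compressible X G V" using assms(4) by blast
  \<comment> \<open>On the empty space micro-support is vacuous and gives no non-trivial element;
    compressibility excludes this case.\<close>
  have X: "topspace X \<noteq> {}" using V(2) by (auto simp: compressible_def)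
  have ms: "micro_supported X M"
    unfolding M_def using assms(1-3) V by (rule micro_supported_monolith)
  have "is_simple (?H\<lparr>carrier := M\<rparr>)" if "openin X W" "compressible X M W" for W
  proof -
    have "monolith (?H\<lparr>carrier := M\<rparr>) \<noteq> {\<one>\<^bsub>?H\<^esub>}"
      \<comment> \<open>The same result is now applied to \<open>M\<close> in place of
        \<open>G\<close>: \<open>M\<close> is micro-supported by \<open>ms\<close>, and
        \<open>W\<close> is its compressible open set.\<close>
      using micro_supported_monolith [OF assms(1) M ms that] X by (rule micro_supported_nontrivial)
    then show ?thesis
      using G.is_simple_monolith by (simp add: M_def)
  qed
  then show ?thesis
    using micro_supported_nontrivial [OF ms X] by (auto simp: Let_def M_def [symmetric])
qed

end
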